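(* Let $\mathcal{B}$ be the set of all lower bounds for a finite support set $S$, sample size $n$ and confidence level $1-\alpha$. If a lower bound $B\in\mathcal{B}$ is admissible with respect to $\mathcal{B}$, then $B$ is conditionally optimal for some total order on the sample space $\Omega(S,n)$.
   Context: Fix a finite nonempty set $S\subset\mathbb{R}$, an integer $n\ge 1$ and $\alpha\in(0,1)$ (the confidence level is $1-\alpha$). The sample space is $\Omega=\Omega(S,n)=\{(x_1,\dots,x_n)\in S^n: x_1\le\dots\le x_n\}$, with $N=|\Omega|$. $\mathcal{F}=\mathcal{F}(S)$ is the closed simplex of all probability distributions on $S$ (zero masses allowed), with the Euclidean topology on mass vectors, and $\mu(F)=\sum_{s\in S}sF(s)$. For $x\in\Omega$ containing $\hat x_s$ copies of $s$, $\Pr_F(x)=\frac{n!}{\prod_{s}\hat x_s!}\prod_{s\in S}F(s)^{\hat x_s}$ (with $0^0=1$), and $\Pr_F(A)=\sum_{x\in A}\Pr_F(x)$ for $A\subseteq\Omega$. A lower bound is any map $B:\Omega\to[-\infty,\infty]$. It is valid if $\Pr_F(\{x\in\Omega: B(x)>\mu(F)\})\le\alpha$ for every $F\in\mathcal{F}$. For valid bounds, $B_1$ dominates $B_2$ if $B_1(x)\ge B_2(x)$ for all $x\in\Omega$ with strict inequality for at least one $x$. A bound $B$ is admissible with respect to $\mathcal{B}$ if it is valid and no valid bound in $\mathcal{B}$ dominates it. A total order $T$ on $\Omega$ is an enumeration $(x_{t_1},\dots,x_{t_N})$ of $\Omega$; a bound $B$ is consistent with $T$ if $B(x_{t_1})\le\dots\le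 B(x_{t_N})$. A bound is conditionally optimal for $T$ if it is valid, consistent with $T$, and dominates every other valid bound consistent with $T$. Classically (Buehler), for each $T$ exactly one such bound $B_T^*$ exists, given by $B_T^*(x_{t_k})=\min_{F\in\mathcal{F}_k}\mu(F)$ if $\mathcal{F}_k\neq\emptyset$ and $B_T^*(x_{t_k})=\infty$ if $\mathcal{F}_k=\emptyset$, where $\Omega_k=\{x_{t_k},\dots,x_{t_N}\}$ and $\mathcal{F}_k$ is the closure of $\{F\in\mathcal{F}:\Pr_F(\Omega_k)>\alpha\}$. *)

theory Defs
  imports "HOL-Probability.Probability_Mass_Function" "HOL-Combinatorics.Multiset_Permutations"
begin

definition sample_space :: "real set \<Rightarrow> nat \<Rightarrow> real list set" where
  "sample_space S n = {x. length x = n \<and> set x \<subseteq> S \<and> sorted x}"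

text \<open>Zero masses are allowed: the support of \<open>F\<close> may be a proper subset of \<open>S\<close>.\<close>
definition distributions :: "real set \<Rightarrow> real pmf set" where
  "distributions S = {F. set_pmf F \<subseteq> S}"

definition mean :: "real set \<Rightarrow> real pmf \<Rightarrow> real" where
  "mean S F = (\<Sum>s\<in>S. s * pmf F s)"

text \<open>The probability that the order statistics of an i.i.d. sample of size \<open>n\<close> from \<open>F\<close>
  equal the sorted list \<open>x\<close>.\<close>
definition sample_prob :: "real set \<Rightarrow> nat \<Rightarrow> real pmf \<Rightarrow> real list \<Rightarrow> real" where
  "sample_prob S n F x =
     fact n / (\<Prod>s\<in>S. fact (count_list x s)) * (\<Prod>s\<in>S. pmf F s ^ count_list x s)"

definition event_prob :: "real set \<Rightarrow> nat \<Rightarrow> real pmf \<Rightarrow> real list set \<Rightarrow> real" where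
  "event_prob S n F A = (\<Sum>x\<in>A. sample_prob S n F x)"

text \<open>Bounds are extensional functions, so that equality of bounds is equality as maps on the
  sample space.\<close>
definition lower_bounds :: "real set \<Rightarrow> nat \<Rightarrow> (real list \<Rightarrow> ereal) set" where
  "lower_bounds S n = sample_space S n \<rightarrow>\<^sub>E UNIV"

definition valid_bound :: "real set \<Rightarrow> nat \<Rightarrow> real \<Rightarrow> (real list \<Rightarrow> ereal) \<Rightarrow> bool" where
  "valid_bound S n \<alpha> B \<longleftrightarrow>
     B \<in> lower_bounds S n \<and>
     (\<forall>F\<in>distributions S. event_prob S n F {x \<in> sample_space S n. B x > ereal (mean S F)} \<le> \<alpha>)"

definition dominates ::
    "real set \<Rightarrow> nat \<Rightarrow> (real list \<Rightarrow> ereal) \<Rightarrow> (real list \<Rightarrow> ereal) \<Rightarrow> bool" where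
  "dominates S n B1 B2 \<longleftrightarrow>
     (\<forall>x\<in>sample_space S n. B1 x \<ge> B2 x) \<and> (\<exists>x\<in>sample_space S n. B1 x > B2 x)"

definition admissible ::
    "real set \<Rightarrow> nat \<Rightarrow> real \<Rightarrow> (real list \<Rightarrow> ereal) set \<Rightarrow> (real list \<Rightarrow> ereal) \<Rightarrow> bool" where
  "admissible S n \<alpha> \<B> B \<longleftrightarrow>
     valid_bound S n \<alpha> B \<and> \<not> (\<exists>B'\<in>\<B>. valid_bound S n \<alpha> B' \<and> dominates S n B' B)"

text \<open>A total order is an enumeration of the sample space without repetition.\<close>
definition total_orders :: "real set \<Rightarrow> nat \<Rightarrow> real list list set" where
  "total_orders S n = permutations_of_set (sample_space S n)"

definition consistent :: "real list list \<Rightarrow> (real list \<Rightarrow> ereal) \<Rightarrow> bool" where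
  "consistent T B \<longleftrightarrow> sorted (map B T)"

definition conditionally_optimal ::
    "real set \<Rightarrow> nat \<Rightarrow> real \<Rightarrow> real list list \<Rightarrow> (real list \<Rightarrow> ereal) \<Rightarrow> bool" where
  "conditionally_optimal S n \<alpha> T B \<longleftrightarrow>
     valid_bound S n \<alpha> B \<and> consistent T B \<and>
     (\<forall>B'. valid_bound S n \<alpha> B' \<and> consistent T B' \<and> B' \<noteq> B \<longrightarrow> dominates S n B B')"

end

theory Submission
  imports Defs
begin

text \<open>Let \<open>T\<close> enumerate the sample space in order of increasing \<open>B\<close>, ties broken arbitrarily. If
  \<open>B'\<close> is another valid bound consistent with \<open>T\<close>, then for each \<open>F\<close> the two error events
  \<open>{B > \<mu>(F)}\<close> and \<open>{B' > \<mu>(F)}\<close> are final segments of the same enumeration, so one contains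
  the other (\<open>superlevel_sets_nested\<close>). The error event of the pointwise maximum is their union,
  that is, one of the two; hence the maximum is valid (\<open>valid_bound_max\<close>). It cannot dominate
  the admissible bound \<open>B\<close>, so it equals \<open>B\<close>, which means \<open>B' \<le> B\<close>.\<close>

lemma finite_sample_space:
  assumes "finite S"
  shows "finite (sample_space S n)"
  by (rule finite_subset[OF _ finite_lists_length_eq[OF assms, of n]])
    (auto simp: sample_space_def)

lemma set_total_order:
  assumes "T \<in> total_orders S n"
  shows "set T = sample_space S n"
  using assms by (simp add: total_orders_def permutations_of_set_def)

lemma exists_consistent_total_order:
  assumes "finite S"
  shows "\<exists>T\<in>total_orders S n. consistent T B"
proof -
  obtain xs where "set xs = sample_space S n" "distinct xs"
    using finite_distinct_list[OF finite_sample_space[OF assms]] by blast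
  then have "sort_key B xs \<in> total_orders S n"
    by (simp add: total_orders_def permutations_of_set_def)
  moreover have "consistent (sort_key B xs) B"
    by (simp add: consistent_def)
  ultimately show ?thesis ..
qed

text \<open>Whichever of \<open>x\<close>, \<open>y\<close> comes first in the enumeration has the smaller value under both
  bounds, so the bounds cannot rank the two points in opposite ways.\<close>
lemma consistent_comonotone:
  assumes "consistent T B" "consistent T B'" "x \<in> set T" "y \<in> set T"
  shows "B x \<le> B y \<and> B' x \<le> B' y \<or> B y \<le> B x \<and> B' y \<le> B' x"
proof -
  obtain i j where "i < length T" "x = T ! i" "j < length T" "y = T ! j"
    using assms(3,4) by (metis in_set_conv_nth)
  then show ?thesis
    using assms(1,2) sorted_nth_mono[of "map B T"] sorted_nth_mono[of "map B' T"]
    unfolding consistent_def by (cases "i \<le> j") auto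
qed

lemma superlevel_sets_nested:
  assumes "consistent T B" "consistent T B'"
  shows "{x \<in> set T. B x > c} \<subseteq> {x \<in> set T. B' x > c} \<or>
         {x \<in> set T. B' x > c} \<subseteq> {x \<in> set T. B x > c}"
proof (rule ccontr)
  assume "\<not> ?thesis"
  then obtain x y where "x \<in> set T" "B x > c" "\<not> B' x > c" "y \<in> set T" "B' y > c" "\<not> B y > c"
    by blast
  then show False
    using consistent_comonotone[OF assms, of x y] by auto
qed

text \<open>The common order is what makes this work: for unrelated valid bounds, the union of two error
  events of probability at most \<open>\<alpha>\<close> can have probability up to \<open>2\<alpha>\<close>. Nestedness reduces the
  union to one of the two events.\<close>
lemma valid_bound_max:
  assumes T: "T \<in> total_orders S n"
    and B: "valid_bound S n \<alpha> B" "consistent T B"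
    and B': "valid_bound S n \<alpha> B'" "consistent T B'"
  shows "valid_bound S n \<alpha> (\<lambda>x\<in>sample_space S n. max (B x) (B' x))" (is "valid_bound S n \<alpha> ?M")
  unfolding valid_bound_def
proof (intro conjI ballI)
  show "?M \<in> lower_bounds S n"
    by (simp add: lower_bounds_def)
next
  fix F assume F: "F \<in> distributions S"
  let ?error = "\<lambda>A. {x \<in> sample_space S n. A x > ereal (mean S F)}"
  have "?error ?M = ?error B \<union> ?error B'"
    by (auto simp: less_max_iff_disj)
  then have "?error ?M = ?error B \<or> ?error ?M = ?error B'"
    using superlevel_sets_nested[OF B(2) B'(2), of "ereal (mean S F)"]
    unfolding set_total_order[OF T] by blast
  moreover have "event_prob S n F (?error B) \<le> \<alpha>" "event_prob S n F (?error B') \<le> \<alpha>"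
    using B(1) B'(1) F by (simp_all add: valid_bound_def)
  ultimately show "event_prob S n F (?error ?M) \<le> \<alpha>"
    by (elim disjE) simp_all
qed

lemma admissible_upper_bound_among_consistent:
  assumes "admissible S n \<alpha> (lower_bounds S n) B"
    and "T \<in> total_orders S n" "consistent T B"
    and "valid_bound S n \<alpha> B'" "consistent T B'"
    and x: "x \<in> sample_space S n"
  shows "B' x \<le> B x"
proof (rule ccontr)
  assume "\<not> B' x \<le> B x"
  let ?M = "\<lambda>x\<in>sample_space S n. max (B x) (B' x)"
  have "valid_bound S n \<alpha> ?M"
    using assms by (intro valid_bound_max) (simp_all add: admissible_def)
  moreover have "dominates S n ?M B"
    unfolding dominates_def using x \<open>\<not> B' x \<le> B x\<close> by (auto simp: less_max_iff_disj not_le)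
  ultimately show False
    using assms(1) by (auto simp: admissible_def valid_bound_def)
qed

theorem lemma3p1:
  fixes S :: "real set" and n :: nat and \<alpha> :: real and B :: "real list \<Rightarrow> ereal"
  assumes "finite S" and "S \<noteq> {}" and "n \<ge> 1" and "0 < \<alpha>" and "\<alpha> < 1"
    and "B \<in> lower_bounds S n"
    and "admissible S n \<alpha> (lower_bounds S n) B"
  shows "\<exists>T\<in>total_orders S n. conditionally_optimal S n \<alpha> T B"
proof -
  obtain T where T: "T \<in> total_orders S n" "consistent T B"
    using exists_consistent_total_order[OF \<open>finite S\<close>] by blast
  have "dominates S n B B'"
    if B': "valid_bound S n \<alpha> B'" "consistent T B'" "B' \<noteq> B" for B'
  proof -
    have le: "B' x \<le> B x" if "x \<in> sample_space S n" for x
      using admissible_upper_bound_among_consistent[OF assms(7) T B'(1,2) that] .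
    \<comment> \<open>Both bounds are extensional, so they can differ only inside the sample space.\<close>
    have "\<exists>x\<in>sample_space S n. B' x \<noteq> B x"
    proof (rule ccontr)
      assume "\<not> ?thesis"
      then have "B' = B"
        using B'(1) assms(6) PiE_ext[of B' "sample_space S n" "\<lambda>_. UNIV" B]
        by (simp add: valid_bound_def lower_bounds_def)
      with B'(3) show False ..
    qed
    then show ?thesis
      unfolding dominates_def using le by (blast intro: order.not_eq_order_implies_strict)
  qed
  moreover have "valid_bound S n \<alpha> B"
    using assms(7) by (simp add: admissible_def)
  ultimately show ?thesis
    using T unfolding conditionally_optimal_def by blast
qed

end
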